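(* Let $(\alpha,\beta)$ be a Bertrand curve pair in $\mathbb{R}^3$, $\beta=\alpha+\lambda N$, where $\alpha$ has Frenet frame $T,N,B$, curvature $\kappa$ and torsion $\tau$, and let $\theta$ be the angle with $T_\beta=\cos\theta\,T+\sin\theta\,B$. Then the following equation, representing the partner curve $\beta$ with respect to the binormal $B$, holds: $$D_B^3B-\Big(\frac{\kappa'}{\kappa}+2\frac{\tau'}{\tau}\Big)D_B^2B+\Big(\Big(\frac{1-\cos\theta}{\sin\theta}\Big)^2(\kappa^2+\tau^2)+2\Big(\frac{\tau'}{\tau}\Big)^2+\frac{\kappa'\tau'}{\kappa\tau}-\frac{\tau''}{\tau}\Big)D_BB+\Big(\kappa\tau\Big(\frac{1-\cos\theta}{\sin\theta}\Big)^2\Big(\frac{\tau}{\kappa}\Big)'\Big)B=0.$$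
   Context: Setting. $\alpha:I\to\mathbb{R}^3$ is a smooth unit speed curve with arc-length parameter $s$, Frenet frame $T,N,B$, curvature $\kappa>0$ and torsion $\tau>0$, with $T'=\kappa N$, $N'=-\kappa T+\tau B$, $B'=-\tau N$. A prime denotes $d/ds$. A Bertrand curve pair $(\alpha,\beta)$ consists of $\alpha$ and a curve $\beta$ having the same principal normal lines at corresponding points; then $\beta(s)=\alpha(s)+\lambda N(s)$ with $\lambda$ a real constant, and there is a real constant $\mu$ with $\lambda\kappa+\mu\tau=1$. It is assumed that $\lambda\neq0$ and $\mu\neq 0$. The unit tangent of $\beta$ is $T_\beta=\beta'/\|\beta'\|=\cos\theta\,T+\sin\theta\,B$, where $\theta$ is a constant angle with $\sin\theta\neq0$. The operator $D_B$. On vector fields along $\alpha$, $D_B$ is the additive operator with $D_B(fX)=f'X+fD_BX$ for smooth functions $f$ of $s$, and $$D_BT=\frac{1-\cos\theta}{\sin\theta}\kappa N,\quad D_BN=-\frac{1-\cos\theta}{\sin\theta}\kappa T+\frac{1-\cos\theta}{\sin\theta}\tau B,\quad D_BB=-\frac{1-\cos\theta}{\sin\theta}\tau N.$$ $D_B^2$ and $D_B^3$ denote iterates of $D_B$. *)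

theory Defs
  imports "HOL-Analysis.Analysis"
begin

text \<open>
  A function on a nondegenerate interval \<open>I\<close> (a scalar function, a curve, or a vector field
  along a curve) is represented by a function on all of \<open>real\<close>; its values outside \<open>I\<close> are
  irrelevant. All derivatives are taken within \<open>I\<close>, hence are one-sided at an end point
  belonging to \<open>I\<close>.
\<close>

definition deriv_on :: "real set \<Rightarrow> (real \<Rightarrow> 'a::real_normed_vector) \<Rightarrow> real \<Rightarrow> 'a" where
  "deriv_on I f s = vector_derivative f (at s within I)"

definition smooth_on :: "real set \<Rightarrow> (real \<Rightarrow> 'a::real_normed_vector) \<Rightarrow> bool" where
  "smooth_on I f \<longleftrightarrow>
     (\<forall>k. \<forall>s\<in>I. ((deriv_on I ^^ k) f) differentiable (at s within I))"

text \<open>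
  The Frenet apparatus of a regular curve with nonvanishing curvature and arbitrary parameter;
  the factor \<open>norm (deriv_on I \<gamma> s)\<close> converts parameter derivatives into arc-length
  derivatives, because the partner of a unit speed curve need not have unit speed.
\<close>

definition unit_tangent :: "real set \<Rightarrow> (real \<Rightarrow> real^3) \<Rightarrow> real \<Rightarrow> real^3" where
  "unit_tangent I \<gamma> s = deriv_on I \<gamma> s /\<^sub>R norm (deriv_on I \<gamma> s)"

definition curvature :: "real set \<Rightarrow> (real \<Rightarrow> real^3) \<Rightarrow> real \<Rightarrow> real" where
  "curvature I \<gamma> s = norm (deriv_on I (unit_tangent I \<gamma>) s) / norm (deriv_on I \<gamma> s)"

definition principal_normal :: "real set \<Rightarrow> (real \<Rightarrow> real^3) \<Rightarrow> real \<Rightarrow> real^3" where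
  "principal_normal I \<gamma> s =
     deriv_on I (unit_tangent I \<gamma>) s /\<^sub>R norm (deriv_on I (unit_tangent I \<gamma>) s)"

definition binormal :: "real set \<Rightarrow> (real \<Rightarrow> real^3) \<Rightarrow> real \<Rightarrow> real^3" where
  "binormal I \<gamma> s = cross3 (unit_tangent I \<gamma> s) (principal_normal I \<gamma> s)"

text \<open>The sign of the torsion is that of \<open>B' = - \<tau> N\<close>.\<close>

definition torsion :: "real set \<Rightarrow> (real \<Rightarrow> real^3) \<Rightarrow> real \<Rightarrow> real" where
  "torsion I \<gamma> s =
     - (deriv_on I (binormal I \<gamma>) s \<bullet> principal_normal I \<gamma> s) / norm (deriv_on I \<gamma> s)"

definition frenet_curve :: "real set \<Rightarrow> (real \<Rightarrow> real^3) \<Rightarrow> bool" where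
  "frenet_curve I \<gamma> \<longleftrightarrow>
     smooth_on I \<gamma> \<and> (\<forall>s\<in>I. deriv_on I \<gamma> s \<noteq> 0) \<and> (\<forall>s\<in>I. curvature I \<gamma> s > 0)"

definition unit_speed :: "real set \<Rightarrow> (real \<Rightarrow> real^3) \<Rightarrow> bool" where
  "unit_speed I \<gamma> \<longleftrightarrow> (\<forall>s\<in>I. norm (deriv_on I \<gamma> s) = 1)"

definition principal_normal_line :: "real set \<Rightarrow> (real \<Rightarrow> real^3) \<Rightarrow> real \<Rightarrow> (real^3) set" where
  "principal_normal_line I \<gamma> s = range (\<lambda>t. \<gamma> s + t *\<^sub>R principal_normal I \<gamma> s)"

definition bertrand_pair ::
    "real set \<Rightarrow> (real \<Rightarrow> real^3) \<Rightarrow> (real \<Rightarrow> real^3) \<Rightarrow> bool" where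
  "bertrand_pair I \<alpha> \<beta> \<longleftrightarrow>
     frenet_curve I \<alpha> \<and> frenet_curve I \<beta> \<and>
     (\<forall>s\<in>I. principal_normal_line I \<alpha> s = principal_normal_line I \<beta> s)"

text \<open>
  The operator \<open>D\<^sub>B\<close> on smooth vector fields along \<open>\<alpha>\<close>, given by additivity, the
  Leibniz rule and its values on the Frenet frame, which determine it on \<open>I\<close>. The
  congruence clause says that \<open>D\<close> acts on vector fields over \<open>I\<close>, i.e. does not see the
  values outside \<open>I\<close> of the representing functions; together with the closure clause it
  makes the iterates meaningful.
\<close>

definition is_D_B ::
    "real set \<Rightarrow> (real \<Rightarrow> real^3) \<Rightarrow> real \<Rightarrow> ((real \<Rightarrow> real^3) \<Rightarrow> real \<Rightarrow> real^3) \<Rightarrow> bool" where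
  "is_D_B I \<alpha> \<theta> D \<longleftrightarrow>
     (\<forall>X. smooth_on I X \<longrightarrow> smooth_on I (D X)) \<and>
     (\<forall>X Y. smooth_on I X \<longrightarrow> smooth_on I Y \<longrightarrow> (\<forall>s\<in>I. X s = Y s) \<longrightarrow> (\<forall>s\<in>I. D X s = D Y s)) \<and>
     (\<forall>X Y. smooth_on I X \<longrightarrow> smooth_on I Y \<longrightarrow>
        (\<forall>s\<in>I. D (\<lambda>u. X u + Y u) s = D X s + D Y s)) \<and>
     (\<forall>(f::real \<Rightarrow> real) X. smooth_on I f \<longrightarrow> smooth_on I X \<longrightarrow>
        (\<forall>s\<in>I. D (\<lambda>u. f u *\<^sub>R X u) s = deriv_on I f s *\<^sub>R X s + f s *\<^sub>R D X s)) \<and>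
     (\<forall>s\<in>I. D (unit_tangent I \<alpha>) s =
        ((1 - cos \<theta>) / sin \<theta> * curvature I \<alpha> s) *\<^sub>R principal_normal I \<alpha> s) \<and>
     (\<forall>s\<in>I. D (principal_normal I \<alpha>) s =
        - ((1 - cos \<theta>) / sin \<theta> * curvature I \<alpha> s) *\<^sub>R unit_tangent I \<alpha> s
        + ((1 - cos \<theta>) / sin \<theta> * torsion I \<alpha> s) *\<^sub>R binormal I \<alpha> s) \<and>
     (\<forall>s\<in>I. D (binormal I \<alpha>) s =
        - ((1 - cos \<theta>) / sin \<theta> * torsion I \<alpha> s) *\<^sub>R principal_normal I \<alpha> s)"

end

theory Submission
  imports Defs
begin

text \<open>
  With respect to the frame the operator \<open>D\<^sub>B\<close> has the Frenet matrix multiplied by the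
  constant \<open>q = (1 - cos \<theta>) / sin \<theta>\<close>, so \<open>D\<^sub>B B = - q\<tau> N\<close>,
  \<open>D\<^sub>B\<^sup>2 B = q\<^sup>2\<kappa>\<tau> T - q\<tau>' N - q\<^sup>2\<tau>\<^sup>2 B\<close> and
  \<open>D\<^sub>B\<^sup>3 B = q\<^sup>2(\<kappa>'\<tau> + 2\<kappa>\<tau>') T + (q\<^sup>3\<tau>(\<kappa>\<^sup>2 + \<tau>\<^sup>2) - q\<tau>'') N - 3q\<^sup>2\<tau>\<tau>' B\<close>.
  The equation is checked coefficient by coefficient. The Leibniz rule of \<open>D\<^sub>B\<close> is only
  available for smooth data, so the Frenet apparatus has to be shown smooth on \<open>I\<close>.
\<close>

section \<open>Derivatives within an interval and differentiability of finite order\<close>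

text \<open>A connected set with more than one point has no isolated points, and nonempty interior
  excludes a singleton. This is what makes derivatives within \<open>I\<close> unique.\<close>

lemma at_within_interval_neq_bot:
  fixes I :: "real set"
  assumes "is_interval I" "interior I \<noteq> {}" "s \<in> I"
  shows "at s within I \<noteq> bot"
proof -
  have "\<nexists>x. I = {x}"
    using assms(2) by auto
  then have "s islimpt I"
    using assms connected_imp_perfect is_interval_connected by blast
  then show ?thesis
    by (simp add: trivial_limit_within)
qed

text \<open>Finite-order version of \<open>smooth_on\<close>, introduced so that closure properties
  can be proved by induction on \<open>n\<close>. With \<open>k < n\<close> the order
  \<open>0\<close> imposes no condition, and order \<open>n\<close> means that derivatives up to the
  \<open>n\<close>-th exist.\<close>

definition differentiable_times ::
    "real set \<Rightarrow> nat \<Rightarrow> (real \<Rightarrow> 'a::real_normed_vector) \<Rightarrow> bool" where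
  "differentiable_times I n f \<longleftrightarrow>
     (\<forall>k<n. \<forall>s\<in>I. ((deriv_on I ^^ k) f) differentiable (at s within I))"

lemma smooth_on_iff_differentiable_times:
  "smooth_on I f \<longleftrightarrow> (\<forall>n. differentiable_times I n f)"
  unfolding smooth_on_def differentiable_times_def by blast

lemma differentiable_times_0 [simp]: "differentiable_times I 0 f"
  by (simp add: differentiable_times_def)

text \<open>The iterate is peeled from the inside, so that an induction hypothesis applies to the
  derivative of \<open>f\<close>.\<close>

lemma differentiable_times_Suc:
  "differentiable_times I (Suc n) f \<longleftrightarrow>
     (\<forall>s\<in>I. f differentiable (at s within I)) \<and> differentiable_times I n (deriv_on I f)"
  unfolding differentiable_times_def
  by (auto simp: less_Suc_eq_0_disj funpow_Suc_right simp del: funpow.simps)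

lemma differentiable_times_mono:
  "differentiable_times I n f \<Longrightarrow> m \<le> n \<Longrightarrow> differentiable_times I m f"
  by (auto simp: differentiable_times_def)

lemma smooth_on_deriv_on: "smooth_on I f \<Longrightarrow> smooth_on I (deriv_on I f)"
  unfolding smooth_on_iff_differentiable_times using differentiable_times_Suc by blast

lemma smooth_on_has_vector_derivative:
  assumes "smooth_on I f" "s \<in> I"
  shows "(f has_vector_derivative deriv_on I f s) (at s within I)"
proof -
  have "f differentiable (at s within I)"
    using assms unfolding smooth_on_def by (metis funpow_0)
  then show ?thesis
    by (simp add: deriv_on_def vector_derivative_works)
qed

text \<open>Chain rule with the gradient \<open>sgn (X s)\<close> of the norm. The product form with
  \<open>inverse\<close> suits the closure rules for products and inverses.\<close>

lemma has_vector_derivative_norm: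
  fixes X :: "real \<Rightarrow> 'a::real_inner"
  assumes "(X has_vector_derivative X') (at s within I)" "X s \<noteq> 0"
  shows "((\<lambda>u. norm (X u)) has_vector_derivative (X s \<bullet> X') * inverse (norm (X s)))
          (at s within I)"
proof -
  have "((\<lambda>u. norm (X u)) has_derivative (\<lambda>h. (h *\<^sub>R X') \<bullet> sgn (X s))) (at s within I)"
    using has_derivative_compose[OF assms(1)[unfolded has_vector_derivative_def]
        has_derivative_norm[OF assms(2)]]
    by simp
  then show ?thesis
    by (simp add: has_vector_derivative_def sgn_div_norm inner_commute mult_ac)
qed

section \<open>Calculus of finite-order differentiability on a set without isolated points\<close>

context
  fixes I :: "real set"
  assumes perfect: "\<forall>s\<in>I. at s within I \<noteq> bot"
begin

text \<open>\<open>vector_derivative\<close> is a choice among derivatives. Uniqueness at points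
  that are not isolated identifies it with any derivative obtained from the rules.\<close>

lemma deriv_on_eqI:
  assumes "(f has_vector_derivative d) (at s within I)" "s \<in> I"
  shows "deriv_on I f s = d"
  unfolding deriv_on_def using assms perfect by (simp add: vector_derivative_within)

text \<open>Derivatives within \<open>I\<close> see only values on \<open>I\<close>, so agreement on
  \<open>I\<close> passes to \<open>deriv_on\<close>. It is needed because a computed derivative
  matches \<open>deriv_on\<close> only on \<open>I\<close>.\<close>

lemma differentiable_times_cong:
  assumes "differentiable_times I n f" "\<And>s. s \<in> I \<Longrightarrow> f s = g s"
  shows "differentiable_times I n g"
  using assms
proof (induction n arbitrary: f g)
  case (Suc n)
  have der: "(g has_vector_derivative deriv_on I f s) (at s within I)" if "s \<in> I" for s
  proof (rule has_vector_derivative_transform[OF that])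
    show "(f has_vector_derivative deriv_on I f s) (at s within I)"
      using Suc.prems(1) that
      by (simp add: differentiable_times_Suc deriv_on_def vector_derivative_works)
  qed (use Suc.prems(2) in simp)
  have "differentiable_times I n (deriv_on I g)"
    by (rule Suc.IH[of "deriv_on I f"])
      (use Suc.prems(1) deriv_on_eqI[OF der] in \<open>auto simp: differentiable_times_Suc\<close>)
  with der show ?case
    by (auto simp: differentiable_times_Suc intro: differentiableI_vector)
qed simp

lemma differentiable_times_SucI:
  assumes "\<And>s. s \<in> I \<Longrightarrow> (f has_vector_derivative f' s) (at s within I)"
    and "differentiable_times I n f'"
  shows "differentiable_times I (Suc n) f"
  unfolding differentiable_times_Suc
  using assms differentiable_times_cong[OF assms(2)] deriv_on_eqI[OF assms(1)]
  by (auto intro: differentiableI_vector)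

lemma differentiable_times_SucD:
  assumes "differentiable_times I (Suc n) f"
  shows "s \<in> I \<Longrightarrow> (f has_vector_derivative deriv_on I f s) (at s within I)"
    and "differentiable_times I n (deriv_on I f)" and "differentiable_times I n f"
  using assms differentiable_times_mono[OF assms, of n]
  by (auto simp: differentiable_times_Suc deriv_on_def vector_derivative_works)

lemma differentiable_times_const: "differentiable_times I n (\<lambda>_. c)"
proof (induction n arbitrary: c)
  case (Suc n)
  show ?case
    by (rule differentiable_times_SucI[OF has_vector_derivative_const Suc.IH])
qed simp

lemma differentiable_times_add:
  assumes "differentiable_times I n f" "differentiable_times I n g"
  shows "differentiable_times I n (\<lambda>s. f s + g s)"
  using assms
proof (induction n arbitrary: f g)
  case (Suc n)
  note f = differentiable_times_SucD[OF Suc.prems(1)]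
  note g = differentiable_times_SucD[OF Suc.prems(2)]
  show ?case
    by (rule differentiable_times_SucI[OF has_vector_derivative_add[OF f(1) g(1)]])
      (auto intro: Suc.IH f g)
qed simp

text \<open>One Leibniz induction serves real products, scalar multiples, inner products and cross
  products. The derivative is a sum of two terms of the same kind, with one factor differentiated,
  hence the induction over arbitrary \<open>f\<close> and \<open>g\<close>.\<close>

lemma differentiable_times_bilinear:
  assumes p: "bounded_bilinear p" and "differentiable_times I n f" "differentiable_times I n g"
  shows "differentiable_times I n (\<lambda>s. p (f s) (g s))"
  using assms(2,3)
proof (induction n arbitrary: f g)
  case (Suc n)
  note f = differentiable_times_SucD[OF Suc.prems(1)]
  note g = differentiable_times_SucD[OF Suc.prems(2)]
  show ?case
    by (rule differentiable_times_SucI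
          [OF bounded_bilinear.has_vector_derivative[OF p f(1) g(1)]])
      (auto intro!: Suc.IH differentiable_times_add f g)
qed simp

text \<open>The derivative contains \<open>inverse (f s)\<close> itself, but only at order
  \<open>n\<close>, where the induction hypothesis supplies it.\<close>

lemma differentiable_times_inverse:
  fixes f :: "real \<Rightarrow> real"
  assumes "differentiable_times I n f" "\<And>s. s \<in> I \<Longrightarrow> f s \<noteq> 0"
  shows "differentiable_times I n (\<lambda>s. inverse (f s))"
  using assms
proof (induction n)
  case (Suc n)
  note f = differentiable_times_SucD[OF Suc.prems(1)]
  have inv: "differentiable_times I n (\<lambda>s. inverse (f s))"
    using Suc.IH f(3) Suc.prems(2) by blast
  note mult = differentiable_times_bilinear[OF bounded_bilinear_mult]
  show ?case
  proof (rule differentiable_times_SucI)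
    fix s assume "s \<in> I"
    then show "((\<lambda>s. inverse (f s)) has_vector_derivative
        (-1) * (deriv_on I f s * (inverse (f s) * inverse (f s)))) (at s within I)"
      using f(1) Suc.prems(2)
      by (auto simp flip: has_real_derivative_iff_has_vector_derivative
          intro!: derivative_eq_intros)
  next
    show "differentiable_times I n
        (\<lambda>s. (-1) * (deriv_on I f s * (inverse (f s) * inverse (f s))))"
      by (intro mult differentiable_times_const f inv)
  qed
qed simp

text \<open>The same bootstrap as for inverses: the derivative is an inner product times
  \<open>inverse (norm (X s))\<close>, which has order \<open>n\<close> by the induction
  hypothesis.\<close>

lemma differentiable_times_norm:
  fixes X :: "real \<Rightarrow> 'a::real_inner"
  assumes "differentiable_times I n X" "\<And>s. s \<in> I \<Longrightarrow> X s \<noteq> 0"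
  shows "differentiable_times I n (\<lambda>s. norm (X s))"
  using assms
proof (induction n)
  case (Suc n)
  note X = differentiable_times_SucD[OF Suc.prems(1)]
  have "differentiable_times I n (\<lambda>s. norm (X s))"
    using Suc.IH X(3) Suc.prems(2) by blast
  then have inv: "differentiable_times I n (\<lambda>s. inverse (norm (X s)))"
    using Suc.prems(2) by (intro differentiable_times_inverse) auto
  show ?case
    by (rule differentiable_times_SucI[OF has_vector_derivative_norm[OF X(1) Suc.prems(2)]])
      (auto intro!: differentiable_times_bilinear[OF bounded_bilinear_mult]
        differentiable_times_bilinear[OF bounded_bilinear_inner] X inv)
qed simp

section \<open>Smooth functions and smoothness of the Frenet apparatus\<close>

lemma smooth_on_const: "smooth_on I (\<lambda>_. c)"
  by (simp add: smooth_on_iff_differentiable_times differentiable_times_const)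

lemma smooth_on_add:
  "smooth_on I f \<Longrightarrow> smooth_on I g \<Longrightarrow> smooth_on I (\<lambda>s. f s + g s)"
  by (simp add: smooth_on_iff_differentiable_times differentiable_times_add)

lemma smooth_on_bilinear:
  "bounded_bilinear p \<Longrightarrow> smooth_on I f \<Longrightarrow> smooth_on I g \<Longrightarrow> smooth_on I (\<lambda>s. p (f s) (g s))"
  by (simp add: smooth_on_iff_differentiable_times differentiable_times_bilinear)

lemmas smooth_on_mult = smooth_on_bilinear[OF bounded_bilinear_mult]
lemmas smooth_on_scaleR = smooth_on_bilinear[OF bounded_bilinear_scaleR]
lemmas smooth_on_inner = smooth_on_bilinear[OF bounded_bilinear_inner]

lemma smooth_on_inverse:
  fixes f :: "real \<Rightarrow> real"
  shows "smooth_on I f \<Longrightarrow> (\<And>s. s \<in> I \<Longrightarrow> f s \<noteq> 0) \<Longrightarrow> smooth_on I (\<lambda>s. inverse (f s))"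
  by (simp add: smooth_on_iff_differentiable_times differentiable_times_inverse)

lemma smooth_on_norm:
  fixes X :: "real \<Rightarrow> 'a::real_inner"
  shows "smooth_on I X \<Longrightarrow> (\<And>s. s \<in> I \<Longrightarrow> X s \<noteq> 0) \<Longrightarrow> smooth_on I (\<lambda>s. norm (X s))"
  by (simp add: smooth_on_iff_differentiable_times differentiable_times_norm)

lemma smooth_on_normalize:
  fixes X :: "real \<Rightarrow> 'a::real_inner"
  shows "smooth_on I X \<Longrightarrow> (\<And>s. s \<in> I \<Longrightarrow> X s \<noteq> 0) \<Longrightarrow> smooth_on I (\<lambda>s. X s /\<^sub>R norm (X s))"
  by (intro smooth_on_scaleR smooth_on_inverse smooth_on_norm) auto

text \<open>Everything arises from \<open>\<gamma>\<close> by differentiation, normalization and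
  bilinear products. Regularity and positive curvature keep the denominators away from zero.\<close>

lemma smooth_on_frenet:
  assumes "frenet_curve I \<gamma>"
  shows "smooth_on I (unit_tangent I \<gamma>)" and "smooth_on I (principal_normal I \<gamma>)"
    and "smooth_on I (binormal I \<gamma>)" and "smooth_on I (curvature I \<gamma>)"
    and "smooth_on I (torsion I \<gamma>)"
proof -
  define V where "V = deriv_on I \<gamma>"
  define W where "W = deriv_on I (unit_tangent I \<gamma>)"
  have V: "smooth_on I V" "\<And>s. s \<in> I \<Longrightarrow> V s \<noteq> 0"
    using assms unfolding frenet_curve_def V_def by (auto intro: smooth_on_deriv_on)
  have inv_V: "smooth_on I (\<lambda>s. inverse (norm (V s)))"
    using V by (intro smooth_on_inverse smooth_on_norm) auto
  have "unit_tangent I \<gamma> = (\<lambda>s. V s /\<^sub>R norm (V s))"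
    by (simp add: fun_eq_iff unit_tangent_def V_def)
  then show T: "smooth_on I (unit_tangent I \<gamma>)"
    using smooth_on_normalize[OF V] by simp
  \<comment> \<open>The norm of \<open>W\<close> is the numerator of the curvature, so positive
    curvature forces \<open>W\<close> to be nonzero.\<close>
  have W: "smooth_on I W" "\<And>s. s \<in> I \<Longrightarrow> W s \<noteq> 0"
    using assms smooth_on_deriv_on[OF T] unfolding frenet_curve_def curvature_def W_def
    by auto
  have "principal_normal I \<gamma> = (\<lambda>s. W s /\<^sub>R norm (W s))"
    by (simp add: fun_eq_iff principal_normal_def W_def)
  then show N: "smooth_on I (principal_normal I \<gamma>)"
    using smooth_on_normalize[OF W] by simp
  have "binormal I \<gamma> = (\<lambda>s. cross3 (unit_tangent I \<gamma> s) (principal_normal I \<gamma> s))"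
    by (simp add: fun_eq_iff binormal_def)
  then show B: "smooth_on I (binormal I \<gamma>)"
    \<comment> \<open>In finite dimension a bilinear map is bounded.\<close>
    using smooth_on_bilinear[OF _ T N, of cross3] bilinear_cross
    by (simp add: bilinear_conv_bounded_bilinear)
  have "curvature I \<gamma> = (\<lambda>s. norm (W s) * inverse (norm (V s)))"
    by (simp add: fun_eq_iff curvature_def V_def W_def divide_inverse)
  then show "smooth_on I (curvature I \<gamma>)"
    using smooth_on_mult[OF smooth_on_norm[OF W] inv_V] by simp
  have "torsion I \<gamma> = (\<lambda>s. (-1) * ((deriv_on I (binormal I \<gamma>) s \<bullet> principal_normal I \<gamma> s)
      * inverse (norm (V s))))"
    by (simp add: fun_eq_iff torsion_def V_def divide_inverse)
  then show "smooth_on I (torsion I \<gamma>)"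
    using smooth_on_mult[OF smooth_on_const smooth_on_mult[OF
          smooth_on_inner[OF smooth_on_deriv_on[OF B] N] inv_V]]
    by metis
qed

section \<open>The operator \<open>D\<close> in frame coordinates\<close>

text \<open>Leibniz rule on each summand, followed by the prescribed values on the frame. The
  expansion of \<open>X\<close> is assumed only on \<open>I\<close>, because that is all that is
  known about an iterate of \<open>D\<close>; in this form the lemma can be applied
  repeatedly.\<close>

lemma D_B_frame_combination:
  fixes a b e :: "real \<Rightarrow> real"
  assumes D: "is_D_B I \<alpha> \<theta> D" and \<alpha>: "frenet_curve I \<alpha>"
    and smooth: "smooth_on I a" "smooth_on I b" "smooth_on I e"
    and X: "smooth_on I X"
      "\<And>u. u \<in> I \<Longrightarrow> X u =
        a u *\<^sub>R unit_tangent I \<alpha> u + b u *\<^sub>R principal_normal I \<alpha> u + e u *\<^sub>R binormal I \<alpha> u"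
    and s: "s \<in> I"
  defines "q \<equiv> (1 - cos \<theta>) / sin \<theta>"
  shows "D X s =
    (deriv_on I a s - q * curvature I \<alpha> s * b s) *\<^sub>R unit_tangent I \<alpha> s
    + (deriv_on I b s + q * curvature I \<alpha> s * a s - q * torsion I \<alpha> s * e s)
        *\<^sub>R principal_normal I \<alpha> s
    + (deriv_on I e s + q * torsion I \<alpha> s * b s) *\<^sub>R binormal I \<alpha> s"
proof -
  define T N B where "T = unit_tangent I \<alpha>" and "N = principal_normal I \<alpha>"
    and "B = binormal I \<alpha>"
  note frame_defs = T_def N_def B_def
  note TNB = smooth_on_frenet(1-3)[OF \<alpha>, folded frame_defs]
  have D_cong: "D X s = D Y s"
    if "smooth_on I X" "smooth_on I Y" "\<And>u. u \<in> I \<Longrightarrow> X u = Y u" for X Y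
    using D s that unfolding is_D_B_def by blast
  have D_add: "D (\<lambda>u. X u + Y u) s = D X s + D Y s"
    if "smooth_on I X" "smooth_on I Y" for X Y
    using D s that unfolding is_D_B_def by blast
  have D_scaleR: "D (\<lambda>u. f u *\<^sub>R X u) s = deriv_on I f s *\<^sub>R X s + f s *\<^sub>R D X s"
    if "smooth_on I f" "smooth_on I X" for f :: "real \<Rightarrow> real" and X
    using D s that unfolding is_D_B_def by blast
  have D_frame: "D T s = (q * curvature I \<alpha> s) *\<^sub>R N s"
    "D N s = - (q * curvature I \<alpha> s) *\<^sub>R T s + (q * torsion I \<alpha> s) *\<^sub>R B s"
    "D B s = - (q * torsion I \<alpha> s) *\<^sub>R N s"
    using D s unfolding is_D_B_def frame_defs q_def by blast+
  \<comment> \<open>The congruence clause replaces \<open>X\<close> by the literal combination, to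
    which additivity and the Leibniz rule apply.\<close>
  have "D X s = D (\<lambda>u. a u *\<^sub>R T u + b u *\<^sub>R N u + e u *\<^sub>R B u) s"
    by (rule D_cong) (auto intro!: smooth_on_add smooth_on_scaleR smooth TNB X
        simp: X(2)[folded frame_defs])
  also have "\<dots> = D (\<lambda>u. a u *\<^sub>R T u) s + D (\<lambda>u. b u *\<^sub>R N u) s + D (\<lambda>u. e u *\<^sub>R B u) s"
    by (simp add: D_add smooth_on_add smooth_on_scaleR smooth TNB)
  also have "\<dots> = (deriv_on I a s - q * curvature I \<alpha> s * b s) *\<^sub>R T s
    + (deriv_on I b s + q * curvature I \<alpha> s * a s - q * torsion I \<alpha> s * e s) *\<^sub>R N s
    + (deriv_on I e s + q * torsion I \<alpha> s * b s) *\<^sub>R B s"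
    by (simp add: D_scaleR smooth TNB D_frame algebra_simps)
  finally show ?thesis
    by (simp add: frame_defs)
qed

text \<open>Each iterate is obtained from the coefficients of the previous one by
  \<open>D_B_frame_combination\<close>, with \<open>q\<close> constant in \<open>s\<close>.\<close>

lemma D_B_iterates_binormal:
  fixes \<alpha> :: "real \<Rightarrow> real^3" and T N B :: "real \<Rightarrow> real^3" and \<kappa> \<tau> :: "real \<Rightarrow> real"
  defines "T \<equiv> unit_tangent I \<alpha>" and "N \<equiv> principal_normal I \<alpha>" and "B \<equiv> binormal I \<alpha>"
    and "\<kappa> \<equiv> curvature I \<alpha>" and "\<tau> \<equiv> torsion I \<alpha>"
  assumes D: "is_D_B I \<alpha> \<theta> D" and \<alpha>: "frenet_curve I \<alpha>" and s: "s \<in> I"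
  defines "q \<equiv> (1 - cos \<theta>) / sin \<theta>"
  shows "D B s = (- q * \<tau> s) *\<^sub>R N s"
    and "(D ^^ 2) B s = (q\<^sup>2 * \<kappa> s * \<tau> s) *\<^sub>R T s + (- q * deriv_on I \<tau> s) *\<^sub>R N s
      + (- q\<^sup>2 * (\<tau> s)\<^sup>2) *\<^sub>R B s"
    and "(D ^^ 3) B s =
      (q\<^sup>2 * (deriv_on I \<kappa> s * \<tau> s + 2 * \<kappa> s * deriv_on I \<tau> s)) *\<^sub>R T s
      + (q ^ 3 * \<tau> s * ((\<kappa> s)\<^sup>2 + (\<tau> s)\<^sup>2) - q * (deriv_on I ^^ 2) \<tau> s) *\<^sub>R N s
      + (- 3 * q\<^sup>2 * \<tau> s * deriv_on I \<tau> s) *\<^sub>R B s"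
proof -
  note defs = T_def N_def B_def \<kappa>_def \<tau>_def q_def
  note smooth = smooth_on_frenet[OF \<alpha>, folded defs]
  note \<tau>' = smooth_on_deriv_on[OF smooth(5)]
  have smooth_D: "smooth_on I (D X)" if "smooth_on I X" for X
    using D that unfolding is_D_B_def by blast
  note combination = D_B_frame_combination[OF D \<alpha>, folded defs]
  have der: "(\<kappa> has_real_derivative deriv_on I \<kappa> u) (at u within I)"
    "(\<tau> has_real_derivative deriv_on I \<tau> u) (at u within I)"
    "(deriv_on I \<tau> has_real_derivative deriv_on I (deriv_on I \<tau>) u) (at u within I)"
    if "u \<in> I" for u
    using that smooth \<tau>'
    by (auto simp: has_real_derivative_iff_has_vector_derivative
        intro: smooth_on_has_vector_derivative)
  have deriv_eq: "deriv_on I f u = d"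
    if "(f has_real_derivative d) (at u within I)" "u \<in> I" for f u d
    using that by (simp add: deriv_on_eqI has_real_derivative_iff_has_vector_derivative)
  \<comment> \<open>Valid at every point of \<open>I\<close>, not only at \<open>s\<close>: the next
    application of \<open>D\<close> needs the coefficients as functions on \<open>I\<close>.\<close>
  have DB: "D B u = (- q * \<tau> u) *\<^sub>R N u" if "u \<in> I" for u
    using D that unfolding is_D_B_def defs by simp
  show "D B s = (- q * \<tau> s) *\<^sub>R N s"
    using DB s .
  have D2B: "D (D B) u = (q\<^sup>2 * \<kappa> u * \<tau> u) *\<^sub>R T u + (- q * deriv_on I \<tau> u) *\<^sub>R N u
      + (- q\<^sup>2 * (\<tau> u)\<^sup>2) *\<^sub>R B u" if u: "u \<in> I" for u
  proof -
    have d: "deriv_on I (\<lambda>u. - q * \<tau> u) u = - q * deriv_on I \<tau> u"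
      using u by (intro deriv_eq) (auto intro!: derivative_eq_intros der)
    have z: "deriv_on I (\<lambda>_. 0 :: real) u = 0"
      using u by (intro deriv_eq) auto
    have "smooth_on I (\<lambda>u. - q * \<tau> u)"
      by (intro smooth_on_mult smooth_on_const smooth)
    \<comment> \<open>\<open>D B\<close> is read as a frame combination with coefficients
      \<open>0\<close>, \<open>- q * \<tau> u\<close> and \<open>0\<close>.\<close>
    note combination[OF smooth_on_const[of 0] this smooth_on_const[of 0]
        smooth_D[OF smooth(3)] _ u, unfolded d z]
    then have "D (D B) u = (0 - q * \<kappa> u * (- q * \<tau> u)) *\<^sub>R T u
      + (- q * deriv_on I \<tau> u + q * \<kappa> u * 0 - q * \<tau> u * 0) *\<^sub>R N u
      + (0 + q * \<tau> u * (- q * \<tau> u)) *\<^sub>R B u"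
      by (simp add: DB)
    then show ?thesis
      by (simp add: power2_eq_square mult_ac)
  qed
  then show "(D ^^ 2) B s = (q\<^sup>2 * \<kappa> s * \<tau> s) *\<^sub>R T s + (- q * deriv_on I \<tau> s) *\<^sub>R N s
      + (- q\<^sup>2 * (\<tau> s)\<^sup>2) *\<^sub>R B s"
    using s by (simp add: numeral_2_eq_2)
  have d: "deriv_on I (\<lambda>u. q\<^sup>2 * \<kappa> u * \<tau> u) s =
      q\<^sup>2 * (deriv_on I \<kappa> s * \<tau> s + \<kappa> s * deriv_on I \<tau> s)"
    "deriv_on I (\<lambda>u. - q * deriv_on I \<tau> u) s = - q * deriv_on I (deriv_on I \<tau>) s"
    "deriv_on I (\<lambda>u. - q\<^sup>2 * (\<tau> u)\<^sup>2) s = - q\<^sup>2 * (2 * \<tau> s * deriv_on I \<tau> s)"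
    using s by (intro deriv_eq; auto intro!: derivative_eq_intros der simp: algebra_simps)+
  have sm: "smooth_on I (\<lambda>u. q\<^sup>2 * \<kappa> u * \<tau> u)" "smooth_on I (\<lambda>u. - q * deriv_on I \<tau> u)"
    "smooth_on I (\<lambda>u. - q\<^sup>2 * (\<tau> u)\<^sup>2)"
    \<comment> \<open>Only the square of \<open>\<tau>\<close> is split into a product;
      \<open>q\<^sup>2\<close> stays a constant.\<close>
    unfolding power2_eq_square[of "\<tau> _"]
    by (intro smooth_on_mult smooth_on_const smooth \<tau>')+
  \<comment> \<open>The factor 2 in the final \<open>T\<close> coefficient and the factor 3 in the
    \<open>B\<close> coefficient come from here: differentiating the old coefficient and turning
    \<open>N\<close> towards \<open>T\<close> and \<open>B\<close> give terms of the same
    shape.\<close>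
  have "D (D (D B)) s =
      (q\<^sup>2 * (deriv_on I \<kappa> s * \<tau> s + \<kappa> s * deriv_on I \<tau> s)
        - q * \<kappa> s * (- q * deriv_on I \<tau> s)) *\<^sub>R T s
      + (- q * deriv_on I (deriv_on I \<tau>) s + q * \<kappa> s * (q\<^sup>2 * \<kappa> s * \<tau> s)
        - q * \<tau> s * (- q\<^sup>2 * (\<tau> s)\<^sup>2)) *\<^sub>R N s
      + (- q\<^sup>2 * (2 * \<tau> s * deriv_on I \<tau> s) + q * \<tau> s * (- q * deriv_on I \<tau> s)) *\<^sub>R B s"
    using combination[OF sm smooth_D[OF smooth_D[OF smooth(3)]] D2B s, unfolded d] by simp
  then show "(D ^^ 3) B s =
      (q\<^sup>2 * (deriv_on I \<kappa> s * \<tau> s + 2 * \<kappa> s * deriv_on I \<tau> s)) *\<^sub>R T s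
      + (q ^ 3 * \<tau> s * ((\<kappa> s)\<^sup>2 + (\<tau> s)\<^sup>2) - q * (deriv_on I ^^ 2) \<tau> s) *\<^sub>R N s
      + (- 3 * q\<^sup>2 * \<tau> s * deriv_on I \<tau> s) *\<^sub>R B s"
    by (simp add: numeral_2_eq_2 numeral_3_eq_3 algebra_simps)
qed

end

section \<open>The third-order equation for the binormal\<close>

theorem theorem2p5:
  fixes I :: "real set" and \<alpha> \<beta> :: "real \<Rightarrow> real^3" and l \<mu> \<theta> :: real
    and T N B :: "real \<Rightarrow> real^3" and \<kappa> \<tau> :: "real \<Rightarrow> real"
    and D :: "(real \<Rightarrow> real^3) \<Rightarrow> real \<Rightarrow> real^3"
  defines "T \<equiv> unit_tangent I \<alpha>" and "N \<equiv> principal_normal I \<alpha>" and "B \<equiv> binormal I \<alpha>"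
    and "\<kappa> \<equiv> curvature I \<alpha>" and "\<tau> \<equiv> torsion I \<alpha>"
  assumes "is_interval I" and "interior I \<noteq> {}"
    and "unit_speed I \<alpha>"
    and "bertrand_pair I \<alpha> \<beta>"
    and "\<forall>s\<in>I. \<tau> s > 0"
    and "\<forall>s\<in>I. \<beta> s = \<alpha> s + l *\<^sub>R N s"
    and "\<forall>s\<in>I. l * \<kappa> s + \<mu> * \<tau> s = 1"
    and "l \<noteq> 0" and "\<mu> \<noteq> 0"
    and "\<forall>s\<in>I. unit_tangent I \<beta> s = cos \<theta> *\<^sub>R T s + sin \<theta> *\<^sub>R B s"
    and "sin \<theta> \<noteq> 0"
    and "is_D_B I \<alpha> \<theta> D"
  shows "\<forall>s\<in>I.
    (D ^^ 3) B s
    - (deriv_on I \<kappa> s / \<kappa> s + 2 * (deriv_on I \<tau> s / \<tau> s)) *\<^sub>R (D ^^ 2) B s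
    + (((1 - cos \<theta>) / sin \<theta>)\<^sup>2 * ((\<kappa> s)\<^sup>2 + (\<tau> s)\<^sup>2)
       + 2 * (deriv_on I \<tau> s / \<tau> s)\<^sup>2
       + deriv_on I \<kappa> s * deriv_on I \<tau> s / (\<kappa> s * \<tau> s)
       - (deriv_on I ^^ 2) \<tau> s / \<tau> s) *\<^sub>R D B s
    + (\<kappa> s * \<tau> s * ((1 - cos \<theta>) / sin \<theta>)\<^sup>2 * deriv_on I (\<lambda>u. \<tau> u / \<kappa> u) s) *\<^sub>R B s
    = 0"
proof
  fix s assume s: "s \<in> I"
  define q where "q = (1 - cos \<theta>) / sin \<theta>"
  have perfect: "\<forall>s\<in>I. at s within I \<noteq> bot"
    using at_within_interval_neq_bot \<open>is_interval I\<close> \<open>interior I \<noteq> {}\<close> by blast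
  have \<alpha>: "frenet_curve I \<alpha>"
    using \<open>bertrand_pair I \<alpha> \<beta>\<close> by (simp add: bertrand_pair_def)
  have pos: "\<kappa> s > 0" "\<tau> s > 0"
    using \<alpha> s \<open>\<forall>s\<in>I. \<tau> s > 0\<close> by (auto simp: frenet_curve_def \<kappa>_def)
  have der: "(\<kappa> has_real_derivative deriv_on I \<kappa> s) (at s within I)"
    "(\<tau> has_real_derivative deriv_on I \<tau> s) (at s within I)"
    using s smooth_on_frenet(4,5)[OF perfect \<alpha>] smooth_on_has_vector_derivative
    unfolding \<kappa>_def \<tau>_def has_real_derivative_iff_has_vector_derivative by blast+
  have "((\<lambda>u. \<tau> u / \<kappa> u) has_real_derivative
      (deriv_on I \<tau> s * \<kappa> s - \<tau> s * deriv_on I \<kappa> s) / (\<kappa> s * \<kappa> s)) (at s within I)"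
    using der pos by (auto intro!: derivative_eq_intros)
  then have quotient: "deriv_on I (\<lambda>u. \<tau> u / \<kappa> u) s =
      (deriv_on I \<tau> s * \<kappa> s - \<tau> s * deriv_on I \<kappa> s) / (\<kappa> s * \<kappa> s)"
    using deriv_on_eqI[OF perfect _ s]
    by (simp add: has_real_derivative_iff_has_vector_derivative)
  note iterates = D_B_iterates_binormal[OF perfect \<open>is_D_B I \<alpha> \<theta> D\<close> \<alpha> s,
      folded T_def N_def B_def \<kappa>_def \<tau>_def q_def]
  \<comment> \<open>Values at \<open>s\<close> become plain real numbers, so that the coefficient
    identities are rational identities in real variables with \<open>k\<close> and \<open>t\<close>
    nonzero.\<close>
  define x y z where "x = deriv_on I \<kappa> s" and "y = deriv_on I \<tau> s"
    and "z = (deriv_on I ^^ 2) \<tau> s"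
  define k t where "k = \<kappa> s" and "t = \<tau> s"
  have nz: "k \<noteq> 0" "t \<noteq> 0"
    using pos by (auto simp: k_def t_def)
  \<comment> \<open>The system is triangular: the \<open>T\<close> component of the equation
    involves only \<open>c2\<close>, the \<open>N\<close> component then fixes \<open>c1\<close>,
    and the \<open>B\<close> component fixes \<open>c0\<close>. The last factor of \<open>c0\<close>
    is the derivative of \<open>\<tau> / \<kappa>\<close> by the quotient rule.\<close>
  define c2 c1 c0 where "c2 = x / k + 2 * (y / t)"
    and "c1 = q\<^sup>2 * (k\<^sup>2 + t\<^sup>2) + 2 * (y / t)\<^sup>2 + x * y / (k * t) - z / t"
    and "c0 = k * t * q\<^sup>2 * ((y * k - t * x) / (k * k))"
  have T_coeff: "q\<^sup>2 * (x * t + 2 * k * y) - c2 * (q\<^sup>2 * k * t) = 0"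
    using nz by (simp add: c2_def field_simps)
  have N_coeff: "q ^ 3 * t * (k\<^sup>2 + t\<^sup>2) - q * z + c2 * q * y - c1 * q * t = 0"
    using nz by (simp add: c2_def c1_def field_simps power2_eq_square power3_eq_cube)
  have B_coeff: "- 3 * q\<^sup>2 * t * y + c2 * (q\<^sup>2 * t\<^sup>2) + c0 = 0"
    using nz by (simp add: c2_def c0_def field_simps power2_eq_square)
  \<comment> \<open>Substitute the frame expansions of the iterates and collect the coefficients of
    \<open>T\<close>, \<open>N\<close> and \<open>B\<close>.\<close>
  have "(D ^^ 3) B s - c2 *\<^sub>R (D ^^ 2) B s + c1 *\<^sub>R D B s + c0 *\<^sub>R B s
    = (q\<^sup>2 * (x * t + 2 * k * y) - c2 * (q\<^sup>2 * k * t)) *\<^sub>R T s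
      + (q ^ 3 * t * (k\<^sup>2 + t\<^sup>2) - q * z + c2 * q * y - c1 * q * t) *\<^sub>R N s
      + (- 3 * q\<^sup>2 * t * y + c2 * (q\<^sup>2 * t\<^sup>2) + c0) *\<^sub>R B s"
    unfolding iterates x_def[symmetric] y_def[symmetric] z_def[symmetric]
      k_def[symmetric] t_def[symmetric]
    by (simp add: algebra_simps)
  also have "\<dots> = 0"
    unfolding T_coeff N_coeff B_coeff by simp
  finally show "(D ^^ 3) B s
    - (deriv_on I \<kappa> s / \<kappa> s + 2 * (deriv_on I \<tau> s / \<tau> s)) *\<^sub>R (D ^^ 2) B s
    + (((1 - cos \<theta>) / sin \<theta>)\<^sup>2 * ((\<kappa> s)\<^sup>2 + (\<tau> s)\<^sup>2)
       + 2 * (deriv_on I \<tau> s / \<tau> s)\<^sup>2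
       + deriv_on I \<kappa> s * deriv_on I \<tau> s / (\<kappa> s * \<tau> s)
       - (deriv_on I ^^ 2) \<tau> s / \<tau> s) *\<^sub>R D B s
    + (\<kappa> s * \<tau> s * ((1 - cos \<theta>) / sin \<theta>)\<^sup>2 * deriv_on I (\<lambda>u. \<tau> u / \<kappa> u) s) *\<^sub>R B s
    = 0"
    unfolding quotient c2_def c1_def c0_def x_def y_def z_def k_def t_def q_def .
qed

end
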